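(* For all integers $k\ge0$ and $s=0,1,\dots,k$, $$C_{s+1,\underbrace{0,\dots,0}_{s}}^{s+1,s+1,k+1}=\sigma(k+1,k-s).$$
   Context: $\sigma(k,s)$ are the Stirling numbers of the second kind (number of partitions of a $k$-element set into $s$ nonempty blocks). For integers $k\ge1$, $1\le s\le k-1$, $1\le m\le s$ and nonnegative integers $\alpha_1,\dots,\alpha_s$ with $\sum_{i=1}^s\alpha_i=m$, $\sum_{i=1}^s i\alpha_i=s$, the numbers $C_{\alpha_1,\dots,\alpha_s}^{s,m,k}$ are the uniquely determined universal numbers (not depending on $u$) such that for every entire or meromorphic function $u$ on $\mathbb{C}$ the operator $A=u(z)\frac{d}{dz}$ satisfies $$A^{k}=u^k\Big(\frac{d}{dz}\Big)^k+\sum_{s=1}^{k-1}\Big(\sum_{m=1}^{s}u^{k-m}\sum_{m,s}C_{\alpha_1,\dots,\alpha_s}^{s,m,k}\Big(\frac{du}{dz}\Big)^{\alpha_1}\cdots\Big(\frac{d^su}{dz^s}\Big)^{\alpha_s}\Big)\Big(\frac{d}{dz}\Big)^{k-s},$$ where $\sum_{m,s}$ is over all nonnegative integers $\alpha_1,\dots,\alpha_s$ with $\sum_{i=1}^s\alpha_i=m$ and $\sum_{i=1}^s i\alpha_i=s$. In addition, $C_{\alpha_1,\dots,\alpha_k}^{k,m,k}=0$ by convention (the coefficient of $(d/dz)^0$ in $A^k$ is $0$). *)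

theory Defs
  imports "HOL-Complex_Analysis.Complex_Analysis" "HOL-Combinatorics.Stirling"
begin

definition vf_op :: "(complex \<Rightarrow> complex) \<Rightarrow> (complex \<Rightarrow> complex) \<Rightarrow> complex \<Rightarrow> complex" where
  "vf_op u f = (\<lambda>z. u z * deriv f z)"

text \<open>A tuple $(\alpha_1,\dots,\alpha_s)$ is a list of length \<open>s\<close>, whose entry at position \<open>i\<close>
  (counted from 0) is $\alpha_{i+1}$.\<close>

definition exponents :: "nat \<Rightarrow> nat \<Rightarrow> nat list set" where
  "exponents s m =
     {\<alpha>. length \<alpha> = s \<and> (\<Sum>i<s. \<alpha> ! i) = m \<and> (\<Sum>i<s. (i + 1) * \<alpha> ! i) = s}"

definition deriv_monomial :: "nat list \<Rightarrow> (complex \<Rightarrow> complex) \<Rightarrow> complex \<Rightarrow> complex" where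
  "deriv_monomial \<alpha> u z = (\<Prod>i<length \<alpha>. ((deriv ^^ (i + 1)) u z) ^ (\<alpha> ! i))"

text \<open>\<open>universal_coeffs k D\<close>: the numbers \<open>D s m \<alpha>\<close> are coefficients, the same for all \<open>u\<close>, in the
  expansion of the \<open>k\<close>-th power of the operator \<open>u d/dz\<close>.  Entire functions are included among
  the meromorphic ones.  An identity of meromorphic functions is required only where \<open>u\<close> and \<open>f\<close>
  are both analytic, because a HOL function has arbitrary values at its poles.\<close>

definition universal_coeffs :: "nat \<Rightarrow> (nat \<Rightarrow> nat \<Rightarrow> nat list \<Rightarrow> complex) \<Rightarrow> bool" where
  "universal_coeffs k D \<longleftrightarrow>
     (\<forall>u f z. u meromorphic_on UNIV \<longrightarrow> f meromorphic_on UNIV \<longrightarrow>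
        u analytic_on {z} \<longrightarrow> f analytic_on {z} \<longrightarrow>
        (vf_op u ^^ k) f z =
          u z ^ k * (deriv ^^ k) f z +
          (\<Sum>s = 1..k - 1.
             (\<Sum>m = 1..s. u z ^ (k - m) *
                (\<Sum>\<alpha>\<in>exponents s m. D s m \<alpha> * deriv_monomial \<alpha> u z)) *
             (deriv ^^ (k - s)) f z))"

text \<open>\<open>C_coeff s m k \<alpha>\<close> is $C^{s,m,k}_{\alpha_1,\dots,\alpha_s}$, the common value of all universal
  families at the index.  It is meaningful for $1 \le s \le k-1$, $1 \le m \le s$ and
  \<open>\<alpha> \<in> exponents s m\<close>; for \<open>s = k\<close> it is 0 by convention, the coefficient of $(d/dz)^0$ being 0.
  At other indices a universal family is unconstrained and the value is unspecified.\<close>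

definition C_coeff :: "nat \<Rightarrow> nat \<Rightarrow> nat \<Rightarrow> nat list \<Rightarrow> complex" where
  "C_coeff s m k \<alpha> =
     (if s = k then 0 else (THE c. \<exists>D. universal_coeffs k D \<and> D s m \<alpha> = c))"

end

theory Submission
  imports Defs
begin

text \<open>
  The operator \<open>z d/dz\<close> satisfies \<open>(z d/dz)\<^sup>K = (\<Sum>j\<le>K. \<sigma>(K,j) z\<^sup>j (d/dz)\<^sup>j)\<close>.
  For \<open>u = z\<close> every monomial in \<open>u', u'', \<dots>\<close> other than a power of \<open>u'\<close> vanishes, so testing
  a universal expansion at the point \<open>1\<close> on \<open>f = (z - 1)\<^sup>p\<close>, all of whose derivatives at \<open>1\<close>
  but the \<open>p\<close>-th vanish, forces the coefficient of \<open>(u')\<^sup>s\<close> to be \<open>\<sigma>(K, K - s)\<close>.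
  A universal expansion exists because \<open>u d/dz\<close> maps a differential monomial in \<open>u\<close> and \<open>f\<close>
  to a sum of such monomials.
\<close>

section \<open>Existence of a universal family\<close>

text \<open>A monomial in the derivatives of \<open>u\<close> is encoded by the list of its factors, the entry \<open>x\<close>
  standing for the derivative of order \<open>x + 1\<close>.\<close>

definition factors_prod :: "nat list \<Rightarrow> (complex \<Rightarrow> complex) \<Rightarrow> complex \<Rightarrow> complex" where
  "factors_prod xs u z = (\<Prod>x\<leftarrow>xs. (deriv ^^ Suc x) u z)"

definition weight :: "nat list \<Rightarrow> nat" where
  "weight xs = (\<Sum>x\<leftarrow>xs. Suc x)"

text \<open>Every term of the \<open>K\<close>-th power has \<open>K\<close> factors that are
  \<open>u\<close> or one of its derivatives, and \<open>K\<close> differentiations in all. So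
  length and weight of \<open>xs\<close> fix the exponent of \<open>u\<close> and the order on
  \<open>f\<close>.\<close>

definition op_monomial ::
    "nat \<Rightarrow> nat list \<Rightarrow> (complex \<Rightarrow> complex) \<Rightarrow> (complex \<Rightarrow> complex) \<Rightarrow> complex \<Rightarrow> complex" where
  "op_monomial K xs u f z =
     u z ^ (K - length xs) * factors_prod xs u z * (deriv ^^ (K - weight xs)) f z"

text \<open>The product rule on factor lists: one factor at a time is differentiated.\<close>

fun increments :: "nat list \<Rightarrow> nat list list" where
  "increments [] = []"
| "increments (x # xs) = (Suc x # xs) # map ((#) x) (increments xs)"

text \<open>The monomials of \<open>u d/dz\<close> applied to \<open>op_monomial K xs\<close>: the derivative falls on \<open>f\<close>, on a
  factor of \<open>factors_prod\<close>, or on the power of \<open>u\<close>.\<close>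

definition step_monomials :: "nat \<Rightarrow> nat list \<Rightarrow> nat list list" where
  "step_monomials K xs = xs # increments xs @ replicate (K - length xs) (0 # xs)"

text \<open>Coefficients are encoded as multiplicities in the list; equal monomials are never
  merged.\<close>

fun power_monomials :: "nat \<Rightarrow> nat list list" where
  "power_monomials 0 = [[]]"
| "power_monomials (Suc K) = concat (map (step_monomials K) (power_monomials K))"

section \<open>Weights and the leading term\<close>

lemma weight_simps [simp]: "weight [] = 0" "weight (x # xs) = Suc x + weight xs"
  by (simp_all add: weight_def)

lemma length_le_weight: "length xs \<le> weight xs"
  by (induction xs) auto

lemma increments_length_weight:
  "ys \<in> set (increments xs) \<Longrightarrow> length ys = length xs \<and> weight ys = Suc (weight xs)"
  by (induction xs arbitrary: ys) auto

text \<open>The first application of the operator differentiates only \<open>f\<close>, and each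
  later one raises the weight by at most 1. This is why the expansion stops at
  \<open>s = K - 1\<close>.\<close>

lemma weight_power_monomials:
  "xs \<in> set (power_monomials K) \<Longrightarrow> weight xs \<le> K - 1"
proof (induction K arbitrary: xs)
  case (Suc K)
  then obtain ys where ys: "ys \<in> set (power_monomials K)" "xs \<in> set (step_monomials K ys)"
    by auto
  have "weight ys \<le> K - 1"
    using Suc.IH ys(1) by blast
  \<comment> \<open>From \<open>K = 0\<close> to 1 the bound does not grow; there
    \<open>step_monomials 0 []\<close> is just \<open>[[]]\<close>.\<close>
  moreover have "K = 0 \<Longrightarrow> ys = []"
    using ys(1) by auto
  ultimately show ?case
    using ys(2) by (cases "K = 0")
      (auto simp: step_monomials_def dest: increments_length_weight split: if_splits)
qed simp

lemma filter_Nil_step_monomials: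
  "filter (\<lambda>ys. ys = []) (step_monomials K xs) = (if xs = [] then [[]] else [])"
proof -
  have "\<forall>ys \<in> set (increments xs). ys \<noteq> []"
    by (cases xs) auto
  then show ?thesis
    by (auto simp: step_monomials_def filter_empty_conv)
qed

text \<open>The empty list encodes the leading term. A step yields it only from itself, once, by
  differentiating \<open>f\<close>, so its coefficient stays 1.\<close>

lemma filter_Nil_power_monomials: "filter (\<lambda>xs. xs = []) (power_monomials K) = [[]]"
proof (induction K)
  case (Suc K)
  have "filter (\<lambda>xs. xs = []) (concat (map (step_monomials K) L)) = filter (\<lambda>xs. xs = []) L" for L
    by (induction L) (auto simp: filter_Nil_step_monomials)
  then show ?case
    using Suc by simp
qed simp

section \<open>Differentiation of the monomials\<close>

lemma vf_op_apply: "vf_op u f z = u z * deriv f z"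
  by (simp add: vf_op_def)

lemma has_field_derivative_higher_deriv:
  assumes "open S" "f holomorphic_on S" "z \<in> S"
  shows "((deriv ^^ n) f has_field_derivative (deriv ^^ Suc n) f z) (at z)"
  using holomorphic_derivI[OF holomorphic_higher_deriv[OF assms(2,1)] assms(1,3)] by simp

lemma has_field_derivative_factors_prod:
  assumes "open S" "u holomorphic_on S" "z \<in> S"
  shows "(factors_prod xs u has_field_derivative (\<Sum>ys\<leftarrow>increments xs. factors_prod ys u z)) (at z)"
proof (induction xs)
  case Nil
  then show ?case by (simp add: factors_prod_def[abs_def])
next
  case (Cons x xs)
  have eq: "factors_prod (y # ys) u = (\<lambda>w. (deriv ^^ Suc y) u w * factors_prod ys u w)" for y ys
    by (simp add: factors_prod_def fun_eq_iff)
  show ?case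
    unfolding eq
    using DERIV_mult'[OF has_field_derivative_higher_deriv[OF assms, of "Suc x"] Cons]
    by (simp add: eq sum_list_const_mult o_def add.commute del: funpow.simps)
qed

lemma has_field_derivative_op_monomial:
  assumes "open S" "u holomorphic_on S" "f holomorphic_on S" "z \<in> S"
    and "weight xs \<le> K"
  shows "\<exists>d. (op_monomial K xs u f has_field_derivative d) (at z) \<and>
    u z * d = (\<Sum>ys\<leftarrow>step_monomials K xs. op_monomial (Suc K) ys u f z)"
proof -
  have len: "length xs \<le> K"
    using length_le_weight[of xs] assms(5) by simp
  define n where "n = K - length xs"
  define p where "p = K - weight xs"
  let ?F = "factors_prod xs u z" and ?D = "(deriv ^^ p) f z"
  have du: "(u has_field_derivative deriv u z) (at z)"
    using has_field_derivative_higher_deriv[OF assms(1,2,4), of 0] by simp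
  \<comment> \<open>The three summands differentiate the power of \<open>u\<close>, the factors of
    \<open>xs\<close>, and \<open>f\<close>.\<close>
  define d where "d = (of_nat n * u z ^ (n - 1) * deriv u z * ?F +
      (\<Sum>ys\<leftarrow>increments xs. factors_prod ys u z) * u z ^ n) * ?D +
      (deriv ^^ Suc p) f z * (u z ^ n * ?F)"
  have "((\<lambda>w. u w ^ n * factors_prod xs u w * (deriv ^^ p) f w) has_field_derivative d) (at z)"
    unfolding d_def
    by (rule derivative_eq_intros du has_field_derivative_factors_prod[OF assms(1,2,4)]
        has_field_derivative_higher_deriv[OF assms(1,3,4)] refl)+ (simp add: algebra_simps)
  then have "(op_monomial K xs u f has_field_derivative d) (at z)"
    by (simp add: op_monomial_def[abs_def] n_def p_def)
  moreover have "u z * d = (\<Sum>ys\<leftarrow>step_monomials K xs. op_monomial (Suc K) ys u f z)"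
  proof -
    have "(\<Sum>ys\<leftarrow>increments xs. op_monomial (Suc K) ys u f z) =
        (\<Sum>ys\<leftarrow>increments xs. u z ^ Suc n * ?D * factors_prod ys u z)"
      using len by (intro arg_cong[of _ _ sum_list] map_cong refl)
        (auto simp: op_monomial_def n_def p_def Suc_diff_le dest!: increments_length_weight)
    also have "\<dots> = u z ^ Suc n * ?D * (\<Sum>ys\<leftarrow>increments xs. factors_prod ys u z)"
      by (simp add: sum_list_const_mult)
    finally have inc: "(\<Sum>ys\<leftarrow>increments xs. op_monomial (Suc K) ys u f z) = \<dots>" .
    have xs: "op_monomial (Suc K) xs u f z = u z ^ Suc n * ?F * (deriv ^^ Suc p) f z"
      using len assms(5) by (simp add: op_monomial_def n_def p_def Suc_diff_le)
    have zero: "op_monomial (Suc K) (0 # xs) u f z = u z ^ n * (deriv u z * ?F) * ?D"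
      by (simp add: op_monomial_def n_def p_def factors_prod_def)
    show ?thesis
      unfolding step_monomials_def
      \<comment> \<open>For \<open>n > 0\<close> the outer \<open>u z\<close> restores
        \<open>u z ^ n\<close>; for \<open>n = 0\<close> the first summand of \<open>d\<close>
        vanishes and the \<open>replicate\<close> block is empty.\<close>
      by (cases n) (simp_all add: inc xs zero d_def sum_list_replicate algebra_simps flip: n_def)
  qed
  ultimately show ?thesis by blast
qed

lemma vf_op_power_eq_sum_monomials:
  assumes "open S" "u holomorphic_on S" "f holomorphic_on S" "z \<in> S"
  shows "(vf_op u ^^ K) f z = (\<Sum>xs\<leftarrow>power_monomials K. op_monomial K xs u f z)"
  using assms(4)
proof (induction K arbitrary: z)
  case 0
  then show ?case by (simp add: op_monomial_def factors_prod_def)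
next
  case (Suc K)
  have "\<exists>d. ((\<lambda>w. \<Sum>xs\<leftarrow>L. op_monomial K xs u f w) has_field_derivative d) (at z) \<and>
      u z * d = (\<Sum>ys\<leftarrow>concat (map (step_monomials K) L). op_monomial (Suc K) ys u f z)"
    if "\<forall>xs\<in>set L. weight xs \<le> K" for L
    using that
  proof (induction L)
    case (Cons xs L)
    then obtain d where d:
      "((\<lambda>w. \<Sum>xs\<leftarrow>L. op_monomial K xs u f w) has_field_derivative d) (at z)"
      "u z * d = (\<Sum>ys\<leftarrow>concat (map (step_monomials K) L). op_monomial (Suc K) ys u f z)"
      by auto
    obtain e where e: "(op_monomial K xs u f has_field_derivative e) (at z)"
      "u z * e = (\<Sum>ys\<leftarrow>step_monomials K xs. op_monomial (Suc K) ys u f z)"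
      using has_field_derivative_op_monomial[OF assms(1-3) Suc.prems, of xs K] Cons.prems by auto
    show ?case
      using DERIV_add[OF e(1) d(1)] e(2) d(2)
      by (intro exI[of _ "e + d"]) (simp add: distrib_left)
  qed (auto intro: exI[of _ 0])
  moreover have "\<forall>xs\<in>set (power_monomials K). weight xs \<le> K"
    using weight_power_monomials by fastforce
  ultimately obtain d where d:
    "((\<lambda>w. \<Sum>xs\<leftarrow>power_monomials K. op_monomial K xs u f w) has_field_derivative d) (at z)"
    "u z * d = (\<Sum>ys\<leftarrow>power_monomials (Suc K). op_monomial (Suc K) ys u f z)"
    by fastforce
  \<comment> \<open>The induction hypothesis holds on all of \<open>S\<close>, so both functions
    agree near \<open>z\<close> and share the derivative there.\<close>
  have "((vf_op u ^^ K) f has_field_derivative d) (at z)"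
    using has_field_derivative_transform_within_open[OF d(1) assms(1) Suc.prems] Suc.IH by simp
  then show ?case
    using d(2) by (simp only: funpow.simps(2) o_apply vf_op_apply[of u "(vf_op u ^^ K) f"] DERIV_imp_deriv)
qed

section \<open>From factor lists to exponent tuples\<close>

definition exponents_of :: "nat list \<Rightarrow> nat list" where
  "exponents_of xs = map (count_list xs) [0..<weight xs]"

text \<open>Guarantees that a tuple of length \<open>weight xs\<close>, the length required in
  \<open>exponents\<close>, records every factor.\<close>

lemma lt_weight: "x \<in> set xs \<Longrightarrow> x < weight xs"
  by (induction xs) auto

lemma sum_count_list_times:
  fixes g :: "nat \<Rightarrow> nat"
  assumes "set xs \<subseteq> {..<n}"
  shows "(\<Sum>i<n. g i * count_list xs i) = (\<Sum>x\<leftarrow>xs. g x)"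
  using assms
proof (induction xs)
  case (Cons x xs)
  have "(\<Sum>i<n. g i * count_list (x # xs) i) =
      (\<Sum>i<n. g i * count_list xs i + (if i = x then g i else 0))"
    by (intro sum.cong) auto
  then show ?case
    using Cons by (simp add: sum.distrib)
qed simp

lemma prod_power_count_list:
  fixes g :: "nat \<Rightarrow> complex"
  assumes "set xs \<subseteq> {..<n}"
  shows "(\<Prod>i<n. g i ^ count_list xs i) = (\<Prod>x\<leftarrow>xs. g x)"
  using assms
proof (induction xs)
  case (Cons x xs)
  have "(\<Prod>i<n. g i ^ count_list (x # xs) i) =
      (\<Prod>i<n. g i ^ count_list xs i * (if i = x then g i else 1))"
    by (intro prod.cong) auto
  then show ?case
    using Cons by (simp add: prod.distrib)
qed simp

lemma exponents_of_in_exponents: "exponents_of xs \<in> exponents (weight xs) (length xs)"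
proof -
  have sub: "set xs \<subseteq> {..<weight xs}"
    using lt_weight by auto
  show ?thesis
    using sum_count_list_times[OF sub, of "\<lambda>_. 1"] sum_count_list_times[OF sub, of Suc]
    by (simp add: exponents_def exponents_of_def weight_def sum_list_triv)
qed

lemma deriv_monomial_exponents_of: "deriv_monomial (exponents_of xs) u z = factors_prod xs u z"
proof -
  have sub: "set xs \<subseteq> {..<weight xs}"
    using lt_weight by auto
  show ?thesis
    using prod_power_count_list[OF sub, of "\<lambda>i. (deriv ^^ Suc i) u z"]
    by (simp add: deriv_monomial_def exponents_of_def factors_prod_def)
qed

lemma finite_exponents: "finite (exponents s m)"
proof (rule finite_subset)
  show "exponents s m \<subseteq> {\<alpha>. set \<alpha> \<subseteq> {..m} \<and> length \<alpha> = s}"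
  proof
    fix \<alpha> assume "\<alpha> \<in> exponents s m"
    then have \<alpha>: "length \<alpha> = s" "(\<Sum>i<s. \<alpha> ! i) = m"
      by (auto simp: exponents_def)
    have "\<alpha> ! i \<le> m" if "i < s" for i
      using member_le_sum[of i "{..<s}" "\<lambda>i. \<alpha> ! i"] that \<alpha>(2) by simp
    then show "\<alpha> \<in> {\<alpha>. set \<alpha> \<subseteq> {..m} \<and> length \<alpha> = s}"
      using \<alpha>(1) by (auto simp: in_set_conv_nth)
  qed
qed (simp add: finite_lists_length_eq)

text \<open>Both sides are additive, so each monomial contributes its own family and the families
  add up. \<open>D\<close> is chosen before \<open>u\<close>, \<open>f\<close> and \<open>z\<close>,
  which makes it universal.\<close>

lemma sum_monomials_eq_expansion:
  assumes "\<forall>xs\<in>set L. xs \<noteq> [] \<and> weight xs \<le> K - 1"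
  shows "\<exists>D. \<forall>u f z. (\<Sum>xs\<leftarrow>L. op_monomial K xs u f z) =
    (\<Sum>s = 1..K - 1. (\<Sum>m = 1..s. u z ^ (K - m) *
       (\<Sum>\<alpha>\<in>exponents s m. D s m \<alpha> * deriv_monomial \<alpha> u z)) * (deriv ^^ (K - s)) f z)"
  using assms
proof (induction L)
  case Nil
  show ?case by (intro exI[of _ "\<lambda>_ _ _. 0"]) simp
next
  case (Cons xs L)
  have "\<forall>xs\<in>set L. xs \<noteq> [] \<and> weight xs \<le> K - 1"
    using Cons.prems by simp
  from Cons.IH[OF this] obtain D where D: "\<forall>u f z. (\<Sum>xs\<leftarrow>L. op_monomial K xs u f z) =
    (\<Sum>s = 1..K - 1. (\<Sum>m = 1..s. u z ^ (K - m) *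
       (\<Sum>\<alpha>\<in>exponents s m. D s m \<alpha> * deriv_monomial \<alpha> u z)) * (deriv ^^ (K - s)) f z)"
    by blast
  \<comment> \<open>The indicator of the index of \<open>xs\<close>; the nested conditionals let the
    three sums collapse one by one.\<close>
  define E :: "nat \<Rightarrow> nat \<Rightarrow> nat list \<Rightarrow> complex" where
    "E s m \<alpha> = (if s = weight xs then if m = length xs then if \<alpha> = exponents_of xs
      then 1 else 0 else 0 else 0)" for s m \<alpha>
  \<comment> \<open>Places the index of \<open>xs\<close> within the ranges of \<open>s\<close> and
    \<open>m\<close>.\<close>
  have len: "1 \<le> length xs" "length xs \<le> weight xs" "weight xs \<le> K - 1"
    using Cons.prems length_le_weight by (auto simp: Suc_le_eq)
  have "(\<Sum>s = 1..K - 1. (\<Sum>m = 1..s. u z ^ (K - m) *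
       (\<Sum>\<alpha>\<in>exponents s m. E s m \<alpha> * deriv_monomial \<alpha> u z)) * (deriv ^^ (K - s)) f z)
       = op_monomial K xs u f z" for u f z
  proof -
    have 1: "(\<Sum>\<alpha>\<in>exponents s m. E s m \<alpha> * deriv_monomial \<alpha> u z) =
      (if s = weight xs then if m = length xs then factors_prod xs u z else 0 else 0)" for s m
    proof (cases "s = weight xs \<and> m = length xs")
      case True
      then have "(\<Sum>\<alpha>\<in>exponents s m. E s m \<alpha> * deriv_monomial \<alpha> u z) =
        (\<Sum>\<alpha>\<in>exponents s m. if \<alpha> = exponents_of xs then deriv_monomial \<alpha> u z else 0)"
        by (intro sum.cong) (auto simp: E_def)
      then show ?thesis
        using True exponents_of_in_exponents[of xs]
        by (simp add: finite_exponents deriv_monomial_exponents_of)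
    qed (auto simp: E_def)
    have 2: "(\<Sum>m = 1..s. u z ^ (K - m) *
       (\<Sum>\<alpha>\<in>exponents s m. E s m \<alpha> * deriv_monomial \<alpha> u z)) =
       (if s = weight xs then u z ^ (K - length xs) * factors_prod xs u z else 0)" for s
      unfolding 1 using len by (simp add: if_distrib[of "(*) _"] cong: if_cong)
    show ?thesis
      unfolding 2 using len
      by (simp add: if_distrib[of "\<lambda>x. x * _"] op_monomial_def cong: if_cong)
  qed
  then have sum: "(\<Sum>xs\<leftarrow>xs # L. op_monomial K xs u f z) =
    (\<Sum>s = 1..K - 1. (\<Sum>m = 1..s. u z ^ (K - m) *
       (\<Sum>\<alpha>\<in>exponents s m. (E s m \<alpha> + D s m \<alpha>) * deriv_monomial \<alpha> u z)) *
       (deriv ^^ (K - s)) f z)" for u f z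
    using D by (simp add: distrib_left distrib_right sum.distrib)
  show ?case
    by (intro exI[of _ "\<lambda>s m \<alpha>. E s m \<alpha> + D s m \<alpha>"] allI) (rule sum)
qed

lemma sum_list_filter_split:
  fixes g :: "'a \<Rightarrow> 'b::comm_monoid_add"
  shows "(\<Sum>x\<leftarrow>xs. g x) = (\<Sum>x\<leftarrow>filter P xs. g x) + (\<Sum>x\<leftarrow>filter (\<lambda>x. \<not> P x) xs. g x)"
  by (induction xs) (auto simp: ac_simps)

lemma ex_universal_coeffs: "\<exists>D. universal_coeffs K D"
proof -
  define L where "L = filter (\<lambda>xs. xs \<noteq> []) (power_monomials K)"
  have "\<forall>xs\<in>set L. xs \<noteq> [] \<and> weight xs \<le> K - 1"
    using weight_power_monomials by (auto simp: L_def)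
  from sum_monomials_eq_expansion[OF this] obtain D where
    D: "\<forall>u f z. (\<Sum>xs\<leftarrow>L. op_monomial K xs u f z) =
    (\<Sum>s = 1..K - 1. (\<Sum>m = 1..s. u z ^ (K - m) *
       (\<Sum>\<alpha>\<in>exponents s m. D s m \<alpha> * deriv_monomial \<alpha> u z)) * (deriv ^^ (K - s)) f z)"
    by blast
  have "(vf_op u ^^ K) f z = u z ^ K * (deriv ^^ K) f z + (\<Sum>xs\<leftarrow>L. op_monomial K xs u f z)"
    if an: "u analytic_on {z}" "f analytic_on {z}" for u f z
  proof -
    obtain S where S: "open S" "z \<in> S" "u holomorphic_on S"
      using an(1) by (auto simp: analytic_at)
    obtain T where T: "open T" "z \<in> T" "f holomorphic_on T"
      using an(2) by (auto simp: analytic_at)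
    \<comment> \<open>On the intersection of the neighbourhoods \<open>u\<close> and
      \<open>f\<close> are both holomorphic.\<close>
    have "(vf_op u ^^ K) f z = (\<Sum>xs\<leftarrow>power_monomials K. op_monomial K xs u f z)"
      by (rule vf_op_power_eq_sum_monomials[of "S \<inter> T"])
        (use S T holomorphic_on_subset[OF S(3)] holomorphic_on_subset[OF T(3)] in auto)
    also have "\<dots> = op_monomial K [] u f z + (\<Sum>xs\<leftarrow>L. op_monomial K xs u f z)"
      unfolding L_def
      by (subst sum_list_filter_split[of _ _ "\<lambda>xs. xs = []"])
        (simp add: filter_Nil_power_monomials)
    finally show ?thesis
      by (simp add: op_monomial_def factors_prod_def)
  qed
  then have "universal_coeffs K D"
    unfolding universal_coeffs_def using D by simp
  then show ?thesis
    by blast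
qed

section \<open>The coefficient of a power of the first derivative\<close>

text \<open>Applying \<open>z d/dz\<close> to the \<open>j\<close>-th term gives \<open>j\<close>
  times itself plus a term of index \<open>j + 1\<close>, which is the recurrence of the Stirling
  numbers.\<close>

lemma euler_op_power:
  assumes "f holomorphic_on UNIV"
  shows "(vf_op (\<lambda>z. z) ^^ K) f z = (\<Sum>j\<le>K. of_nat (Stirling K j) * z ^ j * (deriv ^^ j) f z)"
proof (induction K arbitrary: z)
  case (Suc K)
  let ?S = "\<lambda>n j. of_nat (Stirling n j) :: complex" and ?D = "\<lambda>j. (deriv ^^ j) f z"
  have IH: "(vf_op (\<lambda>z. z) ^^ K) f = (\<lambda>z. \<Sum>j\<le>K. ?S K j * z ^ j * (deriv ^^ j) f z)"
    using Suc.IH by blast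
  have "((\<lambda>z. \<Sum>j\<le>K. ?S K j * z ^ j * (deriv ^^ j) f z) has_field_derivative
      (\<Sum>j\<le>K. ?S K j * (of_nat j * z ^ (j - 1) * ?D j + z ^ j * ?D (Suc j)))) (at z)"
    by (rule DERIV_sum derivative_eq_intros refl
        has_field_derivative_higher_deriv[OF open_UNIV assms UNIV_I])+ (simp add: algebra_simps)
  then have "(vf_op (\<lambda>z. z) ^^ Suc K) f z =
      z * (\<Sum>j\<le>K. ?S K j * (of_nat j * z ^ (j - 1) * ?D j + z ^ j * ?D (Suc j)))"
    by (simp add: IH vf_op_apply DERIV_imp_deriv)
  also have "\<dots> = (\<Sum>j\<le>K. of_nat j * ?S K j * z ^ j * ?D j) +
      (\<Sum>j\<le>K. ?S K j * z ^ Suc j * ?D (Suc j))"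
    unfolding sum_distrib_left sum.distrib[symmetric]
  proof (rule sum.cong)
    fix j show "z * (?S K j * (of_nat j * z ^ (j - 1) * ?D j + z ^ j * ?D (Suc j))) =
        of_nat j * ?S K j * z ^ j * ?D j + ?S K j * z ^ Suc j * ?D (Suc j)"
      by (cases j) (simp_all add: algebra_simps)
  qed simp
  \<comment> \<open>The added term is zero because \<open>Stirling K (Suc K) = 0\<close>; it allows
    the index shift that follows.\<close>
  also have "(\<Sum>j\<le>K. of_nat j * ?S K j * z ^ j * ?D j) =
      (\<Sum>j\<le>Suc K. of_nat j * ?S K j * z ^ j * ?D j)"
    by simp
  also have "\<dots> = (\<Sum>j\<le>K. of_nat (Suc j) * ?S K (Suc j) * z ^ Suc j * ?D (Suc j))"
    by (subst sum.atMost_Suc_shift) simp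
  also have "\<dots> + (\<Sum>j\<le>K. ?S K j * z ^ Suc j * ?D (Suc j)) =
      (\<Sum>j\<le>K. ?S (Suc K) (Suc j) * z ^ Suc j * ?D (Suc j))"
    unfolding sum.distrib[symmetric]
    by (intro sum.cong) (simp_all add: algebra_simps del: funpow.simps)
  also have "\<dots> = (\<Sum>j\<le>Suc K. ?S (Suc K) j * z ^ j * ?D j)"
    by (subst sum.atMost_Suc_shift[of _ K]) simp
  finally show ?case .
qed simp

lemma higher_deriv_power_at_center:
  fixes a :: complex
  shows "(deriv ^^ j) (\<lambda>w. (w - a) ^ p) a = (if j = p then fact p else 0)"
proof -
  \<comment> \<open>Here the truncated difference \<open>Suc p - j\<close> is 0.\<close>
  have "pochhammer (of_nat (Suc p - j)) j = (0::complex)" if "p < j"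
    using that by (simp add: pochhammer_0_left)
  then show ?thesis
    unfolding higher_deriv_power
    by (cases j p rule: linorder_cases) (auto simp: pochhammer_fact Suc_diff_le)
qed

text \<open>The first derivative is 1 and the higher ones are 0, so a higher factor is 1 for
  exponent 0, since \<open>0 ^ 0 = 1\<close>, and 0 otherwise.\<close>

lemma deriv_monomial_id:
  "deriv_monomial \<alpha> (\<lambda>z. z) z = (if \<forall>i<length \<alpha>. 0 < i \<longrightarrow> \<alpha> ! i = 0 then 1 else 0)"
proof -
  have "((deriv ^^ (i + 1)) (\<lambda>z. z) z) ^ (\<alpha> ! i) = (if 0 < i \<longrightarrow> \<alpha> ! i = 0 then 1 else 0)"
    for i
    unfolding higher_deriv_ident by auto
  then show ?thesis
    unfolding deriv_monomial_def by (auto intro!: prod.neutral)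
qed

text \<open>If only the first entry can be nonzero, the plain and the weighted sum both equal it,
  which forces \<open>m = s\<close>.\<close>

lemma exponents_first_only:
  assumes "1 \<le> s"
  shows "{\<alpha> \<in> exponents s m. \<forall>i<length \<alpha>. 0 < i \<longrightarrow> \<alpha> ! i = 0} =
    (if m = s then {s # replicate (s - 1) 0} else {})"
proof -
  obtain t where s: "s = Suc t"
    using assms by (cases s) auto
  have only: "\<alpha> = s # replicate t 0 \<and> m = s"
    if "\<alpha> \<in> exponents s m" "\<forall>i<length \<alpha>. 0 < i \<longrightarrow> \<alpha> ! i = 0" for \<alpha>
  proof -
    have "length \<alpha> = Suc t"
      using that(1) by (simp add: exponents_def s)
    then obtain a \<beta> where \<alpha>: "\<alpha> = a # \<beta>" "length \<beta> = t"
      by (auto simp: length_Suc_conv)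
    have "\<beta> ! i = 0" if "i < t" for i
      using \<open>\<forall>i<length \<alpha>. 0 < i \<longrightarrow> \<alpha> ! i = 0\<close>[rule_format, of "Suc i"] \<alpha> that by simp
    then have \<beta>: "\<beta> = replicate t 0"
      using \<alpha> by (simp add: list_eq_iff_nth_eq)
    then show ?thesis
      using that(1) \<alpha> by (simp add: exponents_def s sum.lessThan_Suc_shift del: sum.lessThan_Suc)
  qed
  have mem: "s # replicate t 0 \<in> exponents s s"
    by (simp add: exponents_def s sum.lessThan_Suc_shift del: sum.lessThan_Suc)
  have zero: "\<forall>i<length (s # replicate t 0). 0 < i \<longrightarrow> (s # replicate t 0) ! i = 0"
    by (auto simp: nth_Cons split: nat.split)
  have "{\<alpha> \<in> exponents s m. \<forall>i<length \<alpha>. 0 < i \<longrightarrow> \<alpha> ! i = 0} =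
      {\<alpha>. \<alpha> = s # replicate t 0 \<and> m = s}"
  proof (intro Collect_cong iffI)
    fix \<alpha> assume "\<alpha> = s # replicate t 0 \<and> m = s"
    then show "\<alpha> \<in> exponents s m \<and> (\<forall>i<length \<alpha>. 0 < i \<longrightarrow> \<alpha> ! i = 0)"
      using mem zero by (elim conjE) (simp only: simp_thms)
  qed (use only in blast)
  then show ?thesis
    unfolding s by auto
qed

lemma universal_coeffs_power_of_deriv:
  assumes "universal_coeffs K D" and s: "1 \<le> s" "s \<le> K - 1"
  shows "D s s (s # replicate (s - 1) 0) = of_nat (Stirling K (K - s))"
proof -
  \<comment> \<open>The order of the derivative of \<open>f\<close> multiplying the coefficient
    sought; \<open>p < K\<close>, so the leading term vanishes at 1.\<close>
  define p where "p = K - s"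
  define f :: "complex \<Rightarrow> complex" where "f = (\<lambda>w. (w - 1) ^ p)"
  have hol: "(\<lambda>z. z) holomorphic_on UNIV" "f holomorphic_on UNIV"
    unfolding f_def by (intro holomorphic_intros)+
  then have an: "(\<lambda>z. z) analytic_on A" "f analytic_on A" for A
    by (auto simp: analytic_on_open[OF open_UNIV, symmetric] intro: analytic_on_subset)
  have D: "(vf_op (\<lambda>z. z) ^^ K) f 1 = (deriv ^^ K) f 1 +
     (\<Sum>t = 1..K - 1. (\<Sum>m = 1..t.
        (\<Sum>\<alpha>\<in>exponents t m. D t m \<alpha> * deriv_monomial \<alpha> (\<lambda>z. z) 1)) * (deriv ^^ (K - t)) f 1)"
    using assms(1)[unfolded universal_coeffs_def, rule_format, of "\<lambda>z. z" f 1] an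
    by (simp add: analytic_on_imp_meromorphic_on)
  have f: "(deriv ^^ j) f 1 = (if j = p then fact p else 0)" for j
    unfolding f_def by (rule higher_deriv_power_at_center)
  have inner: "(\<Sum>\<alpha>\<in>exponents t m. D t m \<alpha> * deriv_monomial \<alpha> (\<lambda>z. z) 1) =
      (if m = t then D t t (t # replicate (t - 1) 0) else 0)" if "1 \<le> t" for t m
  proof -
    have "(\<Sum>\<alpha>\<in>exponents t m. D t m \<alpha> * deriv_monomial \<alpha> (\<lambda>z. z) 1) =
      (\<Sum>\<alpha>\<in>{\<alpha> \<in> exponents t m. \<forall>i<length \<alpha>. 0 < i \<longrightarrow> \<alpha> ! i = 0}. D t m \<alpha>)"
      unfolding deriv_monomial_id
      by (subst sum.inter_filter[OF finite_exponents]) (auto intro!: sum.cong)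
    then show ?thesis
      by (simp only: exponents_first_only[OF that]) simp
  qed
  have "(\<Sum>t = 1..K - 1. (\<Sum>m = 1..t.
        (\<Sum>\<alpha>\<in>exponents t m. D t m \<alpha> * deriv_monomial \<alpha> (\<lambda>z. z) 1)) * (deriv ^^ (K - t)) f 1) =
      (\<Sum>t = 1..K - 1. if t = s then D t t (t # replicate (t - 1) 0) * fact p else 0)"
  proof (rule sum.cong)
    fix t assume t: "t \<in> {1..K - 1}"
    \<comment> \<open>Only the summand \<open>t = s\<close> survives; the bounds on \<open>s\<close>
      and \<open>t\<close> keep the subtraction exact.\<close>
    then have "K - t = p \<longleftrightarrow> t = s"
      using s by (auto simp: p_def)
    then show "(\<Sum>m = 1..t. (\<Sum>\<alpha>\<in>exponents t m. D t m \<alpha> * deriv_monomial \<alpha> (\<lambda>z. z) 1)) *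
        (deriv ^^ (K - t)) f 1 = (if t = s then D t t (t # replicate (t - 1) 0) * fact p else 0)"
      using t by (simp add: inner f)
  qed simp
  then have "(vf_op (\<lambda>z. z) ^^ K) f 1 = D s s (s # replicate (s - 1) 0) * fact p"
    using s unfolding D by (simp add: f p_def)
  \<comment> \<open>The Euler expansion at 1 leaves only \<open>j = p\<close>; comparing the two
    values cancels \<open>fact p\<close>.\<close>
  moreover have "(vf_op (\<lambda>z. z) ^^ K) f 1 = of_nat (Stirling K p) * fact p"
    unfolding euler_op_power[OF hol(2)] f
    by (simp add: if_distrib[of "(*) _"] p_def cong: if_cong)
  ultimately show ?thesis
    by (simp add: p_def)
qed

theorem corollary3p2:
  fixes k s :: nat
  assumes "s \<le> k"
  shows "C_coeff (s + 1) (s + 1) (k + 1) ((s + 1) # replicate s 0) = of_nat (Stirling (k + 1) (k - s))"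
proof (cases "s = k")
  case True
  \<comment> \<open>The convention gives 0 on the left, and \<open>Stirling (k + 1) 0 = 0\<close> on
    the right.\<close>
  then show ?thesis by (simp add: C_coeff_def)
next
  case False
  then have val: "D (s + 1) (s + 1) ((s + 1) # replicate s 0) = of_nat (Stirling (k + 1) (k - s))"
    if "universal_coeffs (k + 1) D" for D
    using universal_coeffs_power_of_deriv[OF that, of "s + 1"] assms by simp
  obtain D where "universal_coeffs (k + 1) D"
    using ex_universal_coeffs by blast
  \<comment> \<open>A family exists, and by \<open>val\<close> every family has this value at the
    index, so the description is unique.\<close>
  then have "(THE c. \<exists>D. universal_coeffs (k + 1) D \<and>
      D (s + 1) (s + 1) ((s + 1) # replicate s 0) = c) = of_nat (Stirling (k + 1) (k - s))"
    using val by (intro the_equality) blast+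
  then show ?thesis
    using False by (simp add: C_coeff_def)
qed

end
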